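(* Let $G=(V,E)$ be a finite simple connected graph with $|V|\ge 2$, with distance matrix $D_G$, $M_G:=D_G+2\operatorname{Id}_V$, and blowup-polynomial $p_G$. Let $\mathcal F$ be the family of subsets $I\subset V$ such that the monomial $\prod_{i\in I}n_i$ occurs in $p_G(\mathbf n)$ with nonzero coefficient. Then $\mathcal F$ is the set of feasible subsets of a delta-matroid with ground set $V$. Moreover this delta-matroid is linear: $\mathcal F$ consists precisely of the subsets $I\subset V$ for which the principal submatrix $(M_G)_{I\times I}$ of $M_G$ is nonsingular (the empty principal submatrix being regarded as having determinant $1$).
   Context: For a finite simple connected graph $H$, its distance matrix $D_H$ is the matrix indexed by $V(H)\times V(H)$ whose $(v,w)$ entry is the length of a shortest path from $v$ to $w$ if $v\ne w$, and $0$ if $v=w$. Given a finite simple connected graph $G=(V,E)$ with $|V|\ge 2$ and positive integers $\mathbf n=\{n_v: v\in V\}$, the blowup graph $G[\mathbf n]$ is the finite simple connected graph having $n_v$ copies of each vertex $v\in V$, in which a copy of $v$ is adjacent to a copy of $w$ if and only if $v\neq w$ and $(v,w)\in E$. The blowup-polynomial of $G$ is the unique polynomial $p_G(\mathbf n)\in\mathbb{Z}[\{n_v: v\in V\}]$ (it is known to exist, and to be multi-affine, i.e. of degree at most $1$ in each variable) such that $\det D_{G[\mathbf n]}=(-2)^{\sum_{v}(n_v-1)}p_G(\mathbf n)$ for all $\mathbf n\in\mathbb{Z}_{>0}^V$; here the $n_v$ are regarded as indeterminates. A delta-matroid consists of a finite ground set $E$ and a nonempty family $\mathcal F\subset 2^E$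 (the feasible subsets) such that (1) $\bigcup_{F\in\mathcal F}F=E$; and (2) (symmetric exchange axiom) for all $A,B\in\mathcal F$ and $x\in A\Delta B$ there exists $y\in A\Delta B$ (possibly $y=x$) such that $A\Delta\{x,y\}\in\mathcal F$, where $\Delta$ denotes symmetric difference. *)

theory Defs
  imports
    "HOL-Analysis.Determinants"
    "HOL-Library.Poly_Mapping"
    "Graph_Theory.Graph_Theory"
begin

section \<open>Matrices indexed by a finite set\<close>

text \<open>
  A square matrix with rows and columns indexed by a finite set \<open>I\<close> is a function of two
  arguments restricted to \<open>I\<close>; hence the principal submatrix on \<open>J \<subseteq> I\<close> is the same
  function, and its determinant is \<^term>\<open>det_on J A\<close>.  For \<open>I = {}\<close> the only permutation is the
  identity, and the determinant is \<open>1\<close>.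
\<close>

definition det_on :: "'v set \<Rightarrow> ('v \<Rightarrow> 'v \<Rightarrow> 'r::comm_ring_1) \<Rightarrow> 'r" where
  "det_on I A = (\<Sum>\<pi> | \<pi> permutes I. of_int (sign \<pi>) * (\<Prod>i\<in>I. A i (\<pi> i)))"

lemma det_on_UNIV: "det_on UNIV (\<lambda>i j. A $ i $ j) = det A"
  by (simp add: det_on_def det_def)

lemma det_on_empty: "det_on {} A = 1"
  by (simp add: det_on_def)


section \<open>Distance matrices and blowups of finite simple graphs\<close>

text \<open>
  Finite simple graphs are the \<^locale>\<open>pair_graph\<close>s: an edge between \<open>v\<close> and \<open>w\<close> is represented
  by the two arcs \<open>(v, w)\<close> and \<open>(w, v)\<close>.
\<close>

definition graph_dist :: "'v pair_pre_digraph \<Rightarrow> 'v \<Rightarrow> 'v \<Rightarrow> nat" where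
  "graph_dist G v w =
     (LEAST k. \<exists>p. pre_digraph.apath (with_proj G) v p w \<and> length p = k)"

definition dist_matrix :: "'v pair_pre_digraph \<Rightarrow> 'v \<Rightarrow> 'v \<Rightarrow> int" where
  "dist_matrix G v w = (if v = w then 0 else int (graph_dist G v w))"

definition M_matrix :: "'v pair_pre_digraph \<Rightarrow> 'v \<Rightarrow> 'v \<Rightarrow> int" where
  "M_matrix G v w = dist_matrix G v w + 2 * (if v = w then 1 else 0)"

text \<open>The copies of \<open>v\<close> are \<open>(v, 0), \<dots>, (v, n v - 1)\<close>.\<close>

definition blowup :: "'v pair_pre_digraph \<Rightarrow> ('v \<Rightarrow> nat) \<Rightarrow> ('v \<times> nat) pair_pre_digraph" where
  "blowup G n =
     \<lparr> pverts = (SIGMA v:pverts G. {..<n v}),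
       parcs = {((v, i), (w, j)) | v i w j.
                  v \<noteq> w \<and> (v, w) \<in> parcs G \<and> i < n v \<and> j < n w} \<rparr>"


section \<open>The blowup-polynomial\<close>

text \<open>
  A polynomial is the finitely supported map from monomials to coefficients, a monomial being
  the finitely supported map from variables to exponents.
\<close>

type_synonym 'v int_mpoly = "('v \<Rightarrow>\<^sub>0 nat) \<Rightarrow>\<^sub>0 int"

definition eval_mpoly :: "'v int_mpoly \<Rightarrow> ('v \<Rightarrow> int) \<Rightarrow> int" where
  "eval_mpoly p x =
     (\<Sum>m\<in>Poly_Mapping.keys p.
        Poly_Mapping.lookup p m *
        (\<Prod>v\<in>Poly_Mapping.keys m. x v ^ Poly_Mapping.lookup m v))"

definition is_blowup_poly :: "'v pair_pre_digraph \<Rightarrow> 'v int_mpoly \<Rightarrow> bool" where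
  "is_blowup_poly G p \<longleftrightarrow>
     (\<forall>m\<in>Poly_Mapping.keys p. Poly_Mapping.keys m \<subseteq> pverts G) \<and>
     (\<forall>n :: 'v \<Rightarrow> nat. (\<forall>v\<in>pverts G. 0 < n v) \<longrightarrow>
        det_on (pverts (blowup G n)) (dist_matrix (blowup G n)) =
          (- 2) ^ (\<Sum>v\<in>pverts G. n v - 1) * eval_mpoly p (\<lambda>v. int (n v)))"

definition blowup_poly :: "'v pair_pre_digraph \<Rightarrow> 'v int_mpoly" where
  "blowup_poly G = (THE p. is_blowup_poly G p)"

text \<open>The monomial \<open>\<Prod>i\<in>I. n\<^sub>i\<close>, for finite \<open>I\<close>.\<close>

definition sqfree_monomial :: "'v set \<Rightarrow> ('v \<Rightarrow>\<^sub>0 nat)" where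
  "sqfree_monomial I = (\<Sum>i\<in>I. Poly_Mapping.single i 1)"

definition blowup_feasible :: "'v pair_pre_digraph \<Rightarrow> 'v set set" where
  "blowup_feasible G =
     {I. I \<subseteq> pverts G \<and> Poly_Mapping.lookup (blowup_poly G) (sqfree_monomial I) \<noteq> 0}"


section \<open>Delta-matroids\<close>

definition delta_matroid :: "'e set \<Rightarrow> 'e set set \<Rightarrow> bool" where
  "delta_matroid E \<F> \<longleftrightarrow>
     finite E \<and> \<F> \<noteq> {} \<and> \<F> \<subseteq> Pow E \<and> \<Union>\<F> = E \<and>
     (\<forall>A\<in>\<F>. \<forall>B\<in>\<F>. \<forall>x\<in>sym_diff A B. \<exists>y\<in>sym_diff A B. sym_diff A {x, y} \<in> \<F>)"

end

theory Submission
  imports Defs "Jordan_Normal_Form.Determinant"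
begin

text \<open>
  Write \<open>V\<close> for the vertex set and \<open>M\<close> for \<open>M\<^sub>G\<close>. Two distinct copies of one vertex are at distance
  \<open>2\<close>, because a connected graph with at least two vertices gives every vertex a neighbour, and
  copies of distinct vertices are as far apart as the vertices themselves. Hence the distance matrix
  of the blowup is \<open>N - 2 Id\<close>, where \<open>N\<close> has the entry \<open>M v w\<close> at a copy of \<open>v\<close> and a copy of
  \<open>w\<close> (\<open>dist_matrix_blowup\<close>).

  The determinant of a matrix plus a diagonal one is a sum over principal minors
  (\<open>det_on_add_diag\<close>). A minor of \<open>N\<close> that uses two copies of one vertex vanishes, and the others
  are minors \<open>det M\<^sub>I\<close>, each occurring once for every choice of one copy of each \<open>i \<in> I\<close>
  (\<open>det_on_blowup_matrix\<close>). So the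
  blowup-polynomial is \<open>\<Sum>I\<subseteq>V. (-2)^(|V| - |I|) det M\<^sub>I \<Prod>i\<in>I. n\<^sub>i\<close>; that no other polynomial has the
  defining property follows because a polynomial vanishing at all positive integer points is zero
  (\<open>mpoly_eqI_positive\<close>). Reading off coefficients gives the linear description of the feasible sets.

  The exchange axiom is Bouchet's theorem that the nonsingular principal submatrices of a symmetric
  matrix form a delta-matroid (\<open>symmetric_exchange_det_on\<close>). It is proved here inside the Lagrangian
  space of pairs \<open>(u, M u)\<close>: for each vertex choose one of the two entries \<open>u i\<close>, \<open>(M u) i\<close>, the
  second exactly for \<open>i \<in> I\<close>; the minor on \<open>I\<close> is nonzero iff these chosen entries determine the
  vector. The symmetry of \<open>M\<close> says that the space is isotropic, which is what makes the exchange
  work. Finally, the diagonal entries of \<open>M\<close> equal \<open>2\<close>, so every singleton is feasible and the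
  ground set is covered.
\<close>

section \<open>Determinants over a finite index set\<close>

lemma det_on_cong:
  assumes "\<And>i j. i \<in> I \<Longrightarrow> j \<in> I \<Longrightarrow> A i j = B i j"
  shows "det_on I A = det_on I B"
  unfolding det_on_def
  by (intro sum.cong refl arg_cong2[where f = "(*)"] prod.cong)
     (auto intro!: assms simp: permutes_in_image)

text \<open>
  Expanding the products in the Leibniz formula chooses a set \<open>J\<close> of rows in which the entry of
  \<open>A\<close> is taken; the diagonal factors in the other rows force the permutation to fix \<open>I - J\<close>.
\<close>
lemma det_on_add_diag:
  fixes A :: "'v \<Rightarrow> 'v \<Rightarrow> 'r::comm_ring_1"
  assumes "finite I"
  shows "det_on I (\<lambda>i j. A i j + (if i = j then d i else 0)) =
    (\<Sum>J\<in>Pow I. (\<Prod>i\<in>I - J. d i) * det_on J A)"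
proof -
  let ?t = "\<lambda>J \<pi>. of_int (sign \<pi>) * ((\<Prod>i\<in>J. A i (\<pi> i)) * (\<Prod>i\<in>I - J. if i = \<pi> i then d i else 0))"
  have "det_on I (\<lambda>i j. A i j + (if i = j then d i else 0)) =
      (\<Sum>\<pi> | \<pi> permutes I. \<Sum>J\<in>Pow I. ?t J \<pi>)"
    unfolding det_on_def by (simp add: prod_add[OF assms] sum_distrib_left)
  also have "\<dots> = (\<Sum>J\<in>Pow I. \<Sum>\<pi> | \<pi> permutes I. ?t J \<pi>)"
    by (rule sum.swap)
  also have "\<dots> = (\<Sum>J\<in>Pow I. (\<Prod>i\<in>I - J. d i) * det_on J A)"
  proof (rule sum.cong[OF refl])
    fix J assume "J \<in> Pow I"
    then have J: "J \<subseteq> I" by simp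
    have "(\<Sum>\<pi> | \<pi> permutes I. ?t J \<pi>) = (\<Sum>\<pi> | \<pi> permutes J. ?t J \<pi>)"
    proof (rule sum.mono_neutral_right)
      show "finite {\<pi>. \<pi> permutes I}" using assms by (rule finite_permutations)
      show "{\<pi>. \<pi> permutes J} \<subseteq> {\<pi>. \<pi> permutes I}"
        using J by (auto intro: permutes_subset)
      show "\<forall>\<pi>\<in>{\<pi>. \<pi> permutes I} - {\<pi>. \<pi> permutes J}. ?t J \<pi> = 0"
      proof
        fix \<pi> assume "\<pi> \<in> {\<pi>. \<pi> permutes I} - {\<pi>. \<pi> permutes J}"
        then have p: "\<pi> permutes I" and np: "\<not> \<pi> permutes J" by auto
        have "\<exists>i\<in>I - J. i \<noteq> \<pi> i"
          using np permutes_superset[OF p, of J] by metis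
        then have "(\<Prod>i\<in>I - J. if i = \<pi> i then d i else 0) = 0"
          using assms by (intro prod_zero) auto
        then show "?t J \<pi> = 0" by simp
      qed
    qed
    also have "\<dots> = (\<Sum>\<pi> | \<pi> permutes J. (\<Prod>i\<in>I - J. d i) * (of_int (sign \<pi>) * (\<Prod>i\<in>J. A i (\<pi> i))))"
    proof (rule sum.cong[OF refl])
      fix \<pi> assume "\<pi> \<in> {\<pi>. \<pi> permutes J}"
      then have "(\<Prod>i\<in>I - J. if i = \<pi> i then d i else 0) = (\<Prod>i\<in>I - J. d i)"
        by (intro prod.cong) (auto simp: permutes_not_in)
      then show "?t J \<pi> = (\<Prod>i\<in>I - J. d i) * (of_int (sign \<pi>) * (\<Prod>i\<in>J. A i (\<pi> i)))"
        by (simp add: mult_ac)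
    qed
    finally show "(\<Sum>\<pi> | \<pi> permutes I. ?t J \<pi>) = (\<Prod>i\<in>I - J. d i) * det_on J A"
      by (simp add: det_on_def sum_distrib_left)
  qed
  finally show ?thesis .
qed

text \<open>
  This serves two purposes: passing to matrices indexed by an initial segment of the naturals, and
  identifying a minor on chosen copies of vertices with the minor on the vertices themselves.
\<close>
lemma det_on_reindex:
  assumes "finite I" "inj_on f I"
  shows "det_on (f ` I) A = det_on I (\<lambda>i j. A (f i) (f j))"
proof -
  let ?g = "map_permutation I f"
  have bij: "bij_betw f I (f ` I)" using assms(2) by (simp add: inj_on_imp_bij_betw)
  have bij': "bij_betw (inv_into I f) (f ` I) I" using bij by (rule bij_betw_inv_into)
  have "det_on I (\<lambda>i j. A (f i) (f j)) = det_on (f ` I) A"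
    unfolding det_on_def
  proof (rule sum.reindex_bij_witness[of _ "map_permutation (f ` I) (inv_into I f)" ?g])
    fix \<pi> assume "\<pi> \<in> {\<pi>. \<pi> permutes I}"
    then have p: "\<pi> permutes I" by simp
    show "map_permutation (f ` I) (inv_into I f) (?g \<pi>) = \<pi>"
      by (rule map_permutation_compose_inv[OF bij p]) (use assms in auto)
    show "?g \<pi> \<in> {\<pi>. \<pi> permutes f ` I}"
      using map_permutation_permutes[OF bij p] by simp
    have "(\<Prod>i\<in>f ` I. A i (?g \<pi> i)) = (\<Prod>i\<in>I. A (f i) (f (\<pi> i)))"
      by (subst prod.reindex[OF assms(2)])
         (auto intro!: prod.cong simp: map_permutation_apply[OF assms(2)])
    then show "of_int (sign (?g \<pi>)) * (\<Prod>i\<in>f ` I. A i (?g \<pi> i)) =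
        of_int (sign \<pi>) * (\<Prod>i\<in>I. A (f i) (f (\<pi> i)))"
      by (simp add: sign_map_permutation[OF assms(2) p assms(1)])
  next
    fix \<pi> assume "\<pi> \<in> {\<pi>. \<pi> permutes f ` I}"
    then have p: "\<pi> permutes f ` I" by simp
    show "map_permutation (f ` I) (inv_into I f) \<pi> \<in> {\<pi>. \<pi> permutes I}"
      using map_permutation_permutes[OF bij' p] by simp
    show "?g (map_permutation (f ` I) (inv_into I f) \<pi>) = \<pi>"
      by (rule map_permutation_compose_inv[OF bij' p]) (auto simp: f_inv_into_f)
  qed
  then show ?thesis by simp
qed

lemma det_on_eq_0_iff:
  fixes A :: "'v \<Rightarrow> 'v \<Rightarrow> 'r::idom"
  assumes "finite I"
  shows "det_on I A = 0 \<longleftrightarrow>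
    (\<exists>u. (\<exists>i\<in>I. u i \<noteq> 0) \<and> (\<forall>i\<in>I. (\<Sum>j\<in>I. A i j * u j) = 0))"
proof -
  define n where "n = card I"
  obtain f where f: "bij_betw f {0..<n} I"
    using ex_bij_betw_nat_finite[OF assms] by (auto simp: n_def)
  then have fI: "f ` {0..<n} = I" and inj: "inj_on f {0..<n}"
    by (auto simp: bij_betw_def)
  define g where "g = inv_into {0..<n} f"
  have g: "g (f k) = k" if "k < n" for k using that inj by (simp add: g_def)
  define B where "B = mat n n (\<lambda>(i, j). A (f i) (f j))"
  have B: "B \<in> carrier_mat n n" by (simp add: B_def)
  have "det_on I A = det_on {0..<n} (\<lambda>i j. A (f i) (f j))"
    using det_on_reindex[OF _ inj, of A] by (simp add: fI)
  also have "\<dots> = Determinant.det B"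
    unfolding det_on_def det_def'[OF B]
    by (intro sum.cong refl arg_cong2[where f = "(*)"] prod.cong)
       (auto simp: B_def permutes_in_image)
  finally have det: "det_on I A = Determinant.det B" .
  have row: "(\<Sum>j\<in>I. A (f k) j * u j) = (\<Sum>l<n. A (f k) (f l) * u (f l))" for k u
    using sum.reindex[OF inj, of "\<lambda>j. A (f k) j * u j"] unfolding fI
    by (simp add: o_def atLeast0LessThan)
  have mv: "vec_index (B *\<^sub>v v) k = (\<Sum>l<n. A (f k) (f l) * vec_index v l)"
    if "k < n" "v \<in> carrier_vec n" for k v
    using that by (simp add: B_def scalar_prod_def atLeast0LessThan)
  show ?thesis
    unfolding det det_0_iff_vec_prod_zero[OF B]
  proof
    assume "\<exists>v. v \<in> carrier_vec n \<and> v \<noteq> 0\<^sub>v n \<and> B *\<^sub>v v = 0\<^sub>v n"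
    then obtain v where v: "v \<in> carrier_vec n" "v \<noteq> 0\<^sub>v n" "B *\<^sub>v v = 0\<^sub>v n" by blast
    obtain k where k: "k < n" "vec_index v k \<noteq> 0"
      using v(1,2) by (auto simp: vec_eq_iff)
    show "\<exists>u. (\<exists>i\<in>I. u i \<noteq> 0) \<and> (\<forall>i\<in>I. (\<Sum>j\<in>I. A i j * u j) = 0)"
    proof (intro exI[of _ "\<lambda>i. vec_index v (g i)"] conjI ballI)
      show "\<exists>i\<in>I. vec_index v (g i) \<noteq> 0"
        using k fI g by (intro bexI[of _ "f k"]) auto
      fix i assume "i \<in> I"
      then obtain k where k: "i = f k" "k < n" using fI by auto
      have "(\<Sum>j\<in>I. A i j * vec_index v (g j)) = vec_index (B *\<^sub>v v) k"
        unfolding k(1) row mv[OF k(2) v(1)] by (intro sum.cong) (auto simp: g)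
      then show "(\<Sum>j\<in>I. A i j * vec_index v (g j)) = 0" using v(3) k(2) by simp
    qed
  next
    assume "\<exists>u. (\<exists>i\<in>I. u i \<noteq> 0) \<and> (\<forall>i\<in>I. (\<Sum>j\<in>I. A i j * u j) = 0)"
    then obtain u i where u: "i \<in> I" "u i \<noteq> 0" "\<And>i. i \<in> I \<Longrightarrow> (\<Sum>j\<in>I. A i j * u j) = 0" by blast
    obtain k where k: "i = f k" "k < n" using fI u(1) by auto
    define v where "v = vec n (\<lambda>l. u (f l))"
    have v: "v \<in> carrier_vec n" by (simp add: v_def)
    have "v \<noteq> 0\<^sub>v n"
      using k u(2) by (auto simp: v_def vec_eq_iff)
    moreover have "B *\<^sub>v v = 0\<^sub>v n"
    proof (rule eq_vecI)
      fix l assume "l < dim_vec (0\<^sub>v n :: 'r vec)"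
      then have l: "l < n" by simp
      have "vec_index (B *\<^sub>v v) l = (\<Sum>j\<in>I. A (f l) j * u j)"
        unfolding mv[OF l v] row by (intro sum.cong) (auto simp: v_def)
      also have "\<dots> = 0" using u(3) l fI by auto
      finally show "vec_index (B *\<^sub>v v) l = vec_index (0\<^sub>v n) l" using l by simp
    qed (use B in auto)
    ultimately show "\<exists>v. v \<in> carrier_vec n \<and> v \<noteq> 0\<^sub>v n \<and> B *\<^sub>v v = 0\<^sub>v n" using v by blast
  qed
qed

text \<open>The difference of the two unit vectors lies in the kernel.\<close>
lemma det_on_eq_cols:
  fixes A :: "'v \<Rightarrow> 'v \<Rightarrow> 'r::idom"
  assumes "finite I" "a \<in> I" "b \<in> I" "a \<noteq> b" "\<And>i. i \<in> I \<Longrightarrow> A i a = A i b"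
  shows "det_on I A = 0"
  unfolding det_on_eq_0_iff[OF assms(1)]
proof (intro exI[of _ "\<lambda>i. (if i = a then 1 else 0) - (if i = b then 1 else 0)"] conjI ballI)
  show "\<exists>i\<in>I. (if i = a then 1 else 0) - (if i = b then 1 else 0) \<noteq> (0::'r)"
    using assms(2,4) by (intro bexI[of _ a]) auto
qed (use assms in \<open>simp add: algebra_simps sum_subtractf sum.delta' if_distrib[of "(*) _"] cong: if_cong\<close>)

section \<open>Symmetric exchange for nonsingular principal submatrices\<close>

text \<open>
  For symmetric \<open>M\<close> the vectors \<open>(u, M u)\<close> form a Lagrangian subspace, which is parametrised here by \<open>u\<close>.
  A set \<open>I\<close> selects one entry of each pair \<open>(u i, (M u) i)\<close>; the complement \<open>- I\<close> selects the other one.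
\<close>
definition pivot_coord :: "'v set \<Rightarrow> ('v \<Rightarrow> 'v \<Rightarrow> 'r::comm_ring_1) \<Rightarrow> 'v set \<Rightarrow> ('v \<Rightarrow> 'r) \<Rightarrow> 'v \<Rightarrow> 'r"
  where "pivot_coord V M I u i = (if i \<in> I then \<Sum>j\<in>V. M i j * u j else u i)"

lemma pivot_coord_diff:
  "pivot_coord V M I (\<lambda>j. c * u j - d * w j) i = c * pivot_coord V M I u i - d * pivot_coord V M I w i"
  by (simp add: pivot_coord_def algebra_simps sum_subtractf sum_distrib_left)

lemma pivot_coord_eq_0:
  assumes "\<And>j. j \<in> V \<Longrightarrow> u j = 0" "i \<in> V"
  shows "pivot_coord V M I u i = 0"
  using assms by (auto simp: pivot_coord_def intro!: sum.neutral)

text \<open>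
  A vector whose entries selected by \<open>I\<close> vanish is supported on \<open>I\<close> and is there a kernel vector
  of the principal submatrix on \<open>I\<close>.
\<close>
lemma det_on_ne_0_iff:
  fixes M :: "'v \<Rightarrow> 'v \<Rightarrow> 'r::idom"
  assumes "finite V" "I \<subseteq> V"
  shows "det_on I M \<noteq> 0 \<longleftrightarrow>
    (\<forall>u. (\<forall>i\<in>V. pivot_coord V M I u i = 0) \<longrightarrow> (\<forall>i\<in>V. u i = 0))"
proof -
  have fin: "finite I" using assms finite_subset by blast
  have sum_eq: "(\<Sum>j\<in>V. M i j * u j) = (\<Sum>j\<in>I. M i j * u j)" if "\<forall>j\<in>V - I. u j = 0" for u i
    using assms that by (intro sum.mono_neutral_right) auto
  have "det_on I M = 0 \<longleftrightarrow> (\<exists>u. (\<forall>i\<in>V. pivot_coord V M I u i = 0) \<and> (\<exists>i\<in>V. u i \<noteq> 0))"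
    unfolding det_on_eq_0_iff[OF fin]
  proof
    assume "\<exists>u. (\<exists>i\<in>I. u i \<noteq> 0) \<and> (\<forall>i\<in>I. (\<Sum>j\<in>I. M i j * u j) = 0)"
    then obtain u where u: "\<exists>i\<in>I. u i \<noteq> 0" "\<forall>i\<in>I. (\<Sum>j\<in>I. M i j * u j) = 0" by blast
    let ?u = "\<lambda>i. if i \<in> I then u i else 0"
    have "(\<Sum>j\<in>V. M i j * ?u j) = (\<Sum>j\<in>I. M i j * u j)" for i
      by (subst sum_eq) (auto intro: sum.cong)
    then have "\<forall>i\<in>V. pivot_coord V M I ?u i = 0"
      using u(2) by (simp add: pivot_coord_def)
    moreover have "\<exists>i\<in>V. ?u i \<noteq> 0" using u(1) assms(2) by auto
    ultimately show "\<exists>u. (\<forall>i\<in>V. pivot_coord V M I u i = 0) \<and> (\<exists>i\<in>V. u i \<noteq> 0)"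
      by (intro exI[of _ ?u]) simp
  next
    assume "\<exists>u. (\<forall>i\<in>V. pivot_coord V M I u i = 0) \<and> (\<exists>i\<in>V. u i \<noteq> 0)"
    then obtain u i where u: "\<forall>i\<in>V. pivot_coord V M I u i = 0" and i: "i \<in> V" "u i \<noteq> 0" by blast
    have z: "\<forall>j\<in>V - I. u j = 0" using u by (auto simp: pivot_coord_def)
    with i have "i \<in> I" by auto
    moreover have "\<forall>i\<in>I. (\<Sum>j\<in>I. M i j * u j) = 0"
    proof
      fix i assume i: "i \<in> I"
      then have "pivot_coord V M I u i = 0" using u assms(2) by blast
      with i show "(\<Sum>j\<in>I. M i j * u j) = 0" by (simp add: pivot_coord_def sum_eq[OF z])
    qed
    ultimately show "\<exists>u. (\<exists>i\<in>I. u i \<noteq> 0) \<and> (\<forall>i\<in>I. (\<Sum>j\<in>I. M i j * u j) = 0)"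
      using i(2) by blast
  qed
  then show ?thesis by blast
qed

text \<open>
  The standard symplectic form vanishes on pairs of vectors \<open>(u, M u)\<close>, because \<open>M\<close> is symmetric.
  The signs account for the indices at which \<open>A\<close> swaps the two halves of a pair.
\<close>
lemma pivot_coord_isotropic:
  fixes M :: "'v \<Rightarrow> 'v \<Rightarrow> 'r::comm_ring_1"
  assumes sym: "\<And>i j. i \<in> V \<Longrightarrow> j \<in> V \<Longrightarrow> M i j = M j i"
  shows "(\<Sum>i\<in>V. (if i \<in> A then 1 else - 1) *
      (pivot_coord V M A z i * pivot_coord V M (- A) p i - pivot_coord V M (- A) z i * pivot_coord V M A p i)) = 0"
proof -
  have "(\<Sum>i\<in>V. \<Sum>j\<in>V. z i * M i j * p j) = (\<Sum>j\<in>V. \<Sum>i\<in>V. z i * M i j * p j)"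
    by (rule sum.swap)
  also have "\<dots> = (\<Sum>i\<in>V. \<Sum>j\<in>V. p i * M i j * z j)"
    by (intro sum.cong refl) (simp add: sym mult_ac)
  finally have eq: "(\<Sum>i\<in>V. \<Sum>j\<in>V. z i * M i j * p j) = (\<Sum>i\<in>V. \<Sum>j\<in>V. p i * M i j * z j)" .
  have "(\<Sum>i\<in>V. (if i \<in> A then 1 else - 1) *
      (pivot_coord V M A z i * pivot_coord V M (- A) p i - pivot_coord V M (- A) z i * pivot_coord V M A p i)) =
      (\<Sum>i\<in>V. p i * (\<Sum>j\<in>V. M i j * z j) - z i * (\<Sum>j\<in>V. M i j * p j))"
    by (intro sum.cong) (auto simp: pivot_coord_def algebra_simps)
  also have "\<dots> = 0"
    using eq by (simp add: sum_subtractf sum_distrib_left mult_ac)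
  finally show ?thesis .
qed

text \<open>
  Let \<open>p\<close> be a nonzero vector whose \<open>A\<close>-coordinates vanish at all indices other than \<open>x\<close>, and call the entries
  not selected by \<open>A\<close> its dual coordinates. If the dual coordinate of \<open>p\<close> at \<open>x\<close> is nonzero, then
  \<open>A \<Delta> {x}\<close> is nonsingular. Otherwise some dual coordinate of \<open>p\<close> at a \<open>y \<in> A \<Delta> B\<close> is nonzero,
  for else all \<open>B\<close>-coordinates of \<open>p\<close> would vanish; isotropy then shows that \<open>A \<Delta> {x, y}\<close> is
  nonsingular. Division is avoided by cross-multiplying, so that an integral domain suffices.
\<close>
lemma symmetric_exchange_det_on:
  fixes M :: "'v \<Rightarrow> 'v \<Rightarrow> 'r::idom"
  assumes fin: "finite V"
    and sym: "\<And>i j. i \<in> V \<Longrightarrow> j \<in> V \<Longrightarrow> M i j = M j i"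
    and AB: "A \<subseteq> V" "B \<subseteq> V" "det_on A M \<noteq> 0" "det_on B M \<noteq> 0"
    and x: "x \<in> sym_diff A B"
  shows "\<exists>y\<in>sym_diff A B. det_on (sym_diff A {x, y}) M \<noteq> 0"
proof -
  let ?a = "pivot_coord V M A" and ?q = "pivot_coord V M (- A)"
  have xV: "x \<in> V" using x AB by auto
  have A0: "\<forall>i\<in>V. u i = 0" if "\<And>i. i \<in> V \<Longrightarrow> ?a u i = 0" for u
    using AB(3) that unfolding det_on_ne_0_iff[OF fin AB(1)] by blast
  obtain p where p: "\<And>i. i \<in> V \<Longrightarrow> i \<noteq> x \<Longrightarrow> ?a p i = 0" and px: "?a p x \<noteq> 0"
  proof -
    \<comment> \<open>The rows of \<open>N\<close> are the \<open>A\<close>-coordinate functionals, with the one at \<open>x\<close> replaced by zero, so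
      that \<open>N\<close> is singular.\<close>
    define N where "N i j = (if i = x then 0 else if i \<in> A then M i j else if i = j then 1 else 0)"
      for i j
    have "det_on V N = 0"
      unfolding det_on_def
    proof (rule sum.neutral, rule ballI)
      fix \<pi>
      have "(\<Prod>i\<in>V. N i (\<pi> i)) = 0"
        using fin xV by (intro prod_zero bexI[of _ x]) (auto simp: N_def)
      then show "of_int (sign \<pi>) * (\<Prod>i\<in>V. N i (\<pi> i)) = 0" by simp
    qed
    then obtain u where u: "\<exists>i\<in>V. u i \<noteq> 0" "\<forall>i\<in>V. (\<Sum>j\<in>V. N i j * u j) = 0"
      unfolding det_on_eq_0_iff[OF fin] by blast
    have N: "(\<Sum>j\<in>V. N i j * u j) = ?a u i" if "i \<in> V" "i \<noteq> x" for i
      using that fin by (auto simp: N_def pivot_coord_def if_distrib[of "\<lambda>c. c * _"] cong: if_cong)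
    have a0: "?a u i = 0" if "i \<in> V" "i \<noteq> x" for i
      using u(2) N[OF that] that by simp
    moreover have "?a u x \<noteq> 0" using A0[of u] a0 u(1) by metis
    ultimately show ?thesis by (rule that)
  qed
  \<comment> \<open>A vector with the vanishing \<open>A\<close>-coordinates of \<open>p\<close> is proportional to \<open>p\<close>, so one further
    equation that \<open>p\<close> violates makes it zero.\<close>
  have line: "\<forall>i\<in>V. z i = 0"
    if z: "\<And>i. i \<in> V \<Longrightarrow> i \<noteq> x \<Longrightarrow> ?a z i = 0" and y: "y \<in> V" "?q z y = 0" "?q p y \<noteq> 0" for y z
  proof -
    let ?w = "\<lambda>j. ?a p x * z j - ?a z x * p j"
    have "?a ?w i = 0" if "i \<in> V" for i
      unfolding pivot_coord_diff using p[OF that] z[OF that] by (cases "i = x") simp_all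
    then have "\<forall>i\<in>V. ?w i = 0" by (rule A0)
    then have "?q ?w y = 0" using y(1) by (intro pivot_coord_eq_0) auto
    then have "?a z x = 0" using y(2,3) unfolding pivot_coord_diff by simp
    then show ?thesis using z by (intro A0) metis
  qed
  have subset: "sym_diff A {x, y} \<subseteq> V" if "y \<in> V" for y using that AB(1) xV by auto
  show ?thesis
  proof (cases "?q p x = 0")
    case False
    have "det_on (sym_diff A {x, x}) M \<noteq> 0"
      unfolding det_on_ne_0_iff[OF fin subset[OF xV]]
    proof (intro allI impI)
      fix z assume z: "\<forall>i\<in>V. pivot_coord V M (sym_diff A {x, x}) z i = 0"
      have "?a z i = 0" if "i \<in> V" "i \<noteq> x" for i
        using bspec[OF z that(1)] that by (auto simp: pivot_coord_def split: if_splits)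
      moreover have "?q z x = 0"
        using bspec[OF z xV] by (auto simp: pivot_coord_def split: if_splits)
      ultimately show "\<forall>i\<in>V. z i = 0" using line[OF _ xV _ False] by blast
    qed
    then show ?thesis using x by blast
  next
    case True
    have "\<exists>y\<in>sym_diff A B. ?q p y \<noteq> 0"
    proof (rule ccontr)
      assume neg: "\<not> ?thesis"
      have "pivot_coord V M B p i = 0" if "i \<in> V" for i
      proof (cases "i \<in> sym_diff A B")
        case True
        then have "pivot_coord V M B p i = ?q p i" by (auto simp: pivot_coord_def)
        with neg True show ?thesis by simp
      next
        case False
        then have "pivot_coord V M B p i = ?a p i" by (auto simp: pivot_coord_def)
        moreover have "i \<noteq> x" using False x by blast
        ultimately show ?thesis using p that by simp
      qed
      then have "\<forall>i\<in>V. p i = 0"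
        using AB(4) unfolding det_on_ne_0_iff[OF fin AB(2)] by blast
      then have "?a p x = 0" using xV by (intro pivot_coord_eq_0) auto
      with px show False by simp
    qed
    then obtain y where y: "y \<in> sym_diff A B" "?q p y \<noteq> 0" by blast
    have yV: "y \<in> V" using y AB by auto
    have "det_on (sym_diff A {x, y}) M \<noteq> 0"
      unfolding det_on_ne_0_iff[OF fin subset[OF yV]]
    proof (intro allI impI)
      fix z assume z: "\<forall>i\<in>V. pivot_coord V M (sym_diff A {x, y}) z i = 0"
      have za: "?a z i = 0" if "i \<in> V" "i \<noteq> x" "i \<noteq> y" for i
        using bspec[OF z that(1)] that by (auto simp: pivot_coord_def split: if_splits)
      have zq: "?q z x = 0" "?q z y = 0"
        using bspec[OF z xV] bspec[OF z yV] by (auto simp: pivot_coord_def split: if_splits)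
      let ?s = "\<lambda>i. if i \<in> A then 1 else - 1 :: 'r"
      \<comment> \<open>Of the symplectic form of \<open>z\<close> and \<open>p\<close> only the term at \<open>y\<close> survives.\<close>
      have "0 = (\<Sum>i\<in>V. ?s i * (?a z i * ?q p i - ?q z i * ?a p i))"
        using pivot_coord_isotropic[where V = V and M = M and A = A and z = z and p = p] sym by simp
      also have "\<dots> = (\<Sum>i\<in>{y}. ?s i * (?a z i * ?q p i - ?q z i * ?a p i))"
      proof (rule sum.mono_neutral_right[OF fin])
        show "{y} \<subseteq> V" using yV by simp
        show "\<forall>i\<in>V - {y}. ?s i * (?a z i * ?q p i - ?q z i * ?a p i) = 0"
        proof
          fix i assume i: "i \<in> V - {y}"
          show "?s i * (?a z i * ?q p i - ?q z i * ?a p i) = 0"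
            using i za[of i] p[of i] True zq(1) by (cases "i = x") auto
        qed
      qed
      also have "\<dots> = ?s y * (?a z y * ?q p y)" using zq(2) by simp
      finally have "?a z y = 0" using y(2) by (auto split: if_splits)
      with za have "?a z i = 0" if "i \<in> V" "i \<noteq> x" for i using that by (cases "i = y") auto
      then show "\<forall>i\<in>V. z i = 0" by (rule line[OF _ yV zq(2) y(2)])
    qed
    then show ?thesis using y(1) by blast
  qed
qed

lemma det_on_singleton: "det_on {v} A = A v v"
  by (simp add: det_on_def sign_id)

lemma delta_matroid_nonsingular_principal:
  fixes M :: "'v \<Rightarrow> 'v \<Rightarrow> 'r::idom"
  assumes "finite V"
    and "\<And>i j. i \<in> V \<Longrightarrow> j \<in> V \<Longrightarrow> M i j = M j i"
    and "\<And>v. v \<in> V \<Longrightarrow> M v v \<noteq> 0"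
  shows "delta_matroid V {I. I \<subseteq> V \<and> det_on I M \<noteq> 0}" (is "delta_matroid V ?F")
  unfolding delta_matroid_def
proof (intro conjI ballI)
  show "?F \<noteq> {}" using det_on_empty[of M] by (auto intro!: exI[of _ "{}"])
  show "\<Union>?F = V"
  proof
    show "V \<subseteq> \<Union>?F"
    proof
      fix v assume "v \<in> V"
      then have "{v} \<in> ?F" using assms(3) by (simp add: det_on_singleton)
      then show "v \<in> \<Union>?F" by blast
    qed
  qed auto
  fix A B x assume A: "A \<in> ?F" and B: "B \<in> ?F" and x: "x \<in> sym_diff A B"
  have "\<exists>y\<in>sym_diff A B. det_on (sym_diff A {x, y}) M \<noteq> 0"
  proof (rule symmetric_exchange_det_on[where V = V, OF assms(1,2)])
    show "A \<subseteq> V" "B \<subseteq> V" "det_on A M \<noteq> 0" "det_on B M \<noteq> 0"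
      using A B by blast+
  qed (assumption | rule x)+
  then obtain y where y: "y \<in> sym_diff A B" "det_on (sym_diff A {x, y}) M \<noteq> 0" by blast
  moreover have "sym_diff A {x, y} \<subseteq> V" using A B x y(1) by auto
  ultimately show "\<exists>y\<in>sym_diff A B. sym_diff A {x, y} \<in> ?F" by blast
qed (use assms in auto)

section \<open>Integer polynomials determined by their values at positive integers\<close>

text \<open>
  Induction on the number of variables: with all variables except one fixed at positive integers, a
  univariate polynomial with infinitely many roots remains, so the sum of the terms with any given
  exponent in that variable vanishes as well. Monomials are indexed by an arbitrary set \<open>S\<close> with
  an exponent function \<open>e\<close>, since after discarding a variable the index set cannot be
  read as a set of exponent vectors in the remaining variables without renaming.
\<close>
lemma vanishing_on_positive_imp_coeffs_0:
  fixes c :: "'a \<Rightarrow> int" and e :: "'a \<Rightarrow> 'v \<Rightarrow> nat"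
  assumes "finite V" "finite S"
    and "\<And>m m'. m \<in> S \<Longrightarrow> m' \<in> S \<Longrightarrow> (\<And>v. v \<in> V \<Longrightarrow> e m v = e m' v) \<Longrightarrow> m = m'"
    and "\<And>n :: 'v \<Rightarrow> nat. (\<And>v. v \<in> V \<Longrightarrow> 0 < n v) \<Longrightarrow>
      (\<Sum>m\<in>S. c m * (\<Prod>v\<in>V. int (n v) ^ e m v)) = 0"
    and "m \<in> S"
  shows "c m = 0"
  using assms
proof (induction V arbitrary: S m rule: finite_induct)
  case empty
  have "S = {m}" using empty by auto
  with empty.prems(3)[of "\<lambda>_. 1"] show ?case by simp
next
  case (insert a V S m)
  let ?S = "{m' \<in> S. e m' a = e m a}"
  show ?case
  proof (rule insert.IH[of ?S])
    show "finite ?S" "m \<in> ?S" using insert.prems by auto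
    fix m' m'' assume m: "m' \<in> ?S" "m'' \<in> ?S" "\<And>v. v \<in> V \<Longrightarrow> e m' v = e m'' v"
    show "m' = m''" by (rule insert.prems(2)) (use m in auto)
  next
    fix n :: "'v \<Rightarrow> nat" assume n: "\<And>v. v \<in> V \<Longrightarrow> 0 < n v"
    let ?b = "\<lambda>m. c m * (\<Prod>v\<in>V. int (n v) ^ e m v)"
    \<comment> \<open>The polynomial in the variable \<open>a\<close> obtained by fixing the others at \<open>n\<close>.\<close>
    define P where "P = (\<Sum>m\<in>S. Polynomial.monom (?b m) (e m a))"
    have root: "poly P (int t) = 0" if "t > 0" for t
    proof -
      have V: "(\<Prod>v\<in>V. int ((n(a := t)) v) ^ e m v) = (\<Prod>v\<in>V. int (n v) ^ e m v)" for m
        using insert.hyps by (intro prod.cong) auto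
      have "poly P (int t) = (\<Sum>m\<in>S. c m * (\<Prod>v\<in>insert a V. int ((n(a := t)) v) ^ e m v))"
        unfolding P_def prod.insert[OF insert.hyps] V by (simp add: poly_sum poly_monom mult_ac)
      also have "\<dots> = 0" using n that by (intro insert.prems(3)) auto
      finally show ?thesis .
    qed
    have "P = 0"
    proof (rule ccontr)
      assume "P \<noteq> 0"
      then have "finite {t. poly P t = 0}" by (rule poly_roots_finite)
      moreover have "int ` {0<..} \<subseteq> {t. poly P t = 0}" using root by auto
      ultimately have "finite (int ` {0<..})" using finite_subset by blast
      then show False using finite_imageD[of int "{0<..}"] infinite_Ioi[of "0::nat"] by (auto simp: inj_on_def)
    qed
    then have "0 = coeff P (e m a)" by simp
    also have "\<dots> = (\<Sum>m'\<in>S. if e m' a = e m a then ?b m' else 0)"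
      by (simp add: P_def coeff_sum)
    also have "\<dots> = (\<Sum>m'\<in>?S. ?b m')"
      using insert.prems(1) by (simp add: sum.inter_filter)
    finally show "(\<Sum>m'\<in>?S. ?b m') = 0" by simp
  qed
qed

lemma eval_mpoly_eq_sum:
  assumes "finite V" "finite S" "Poly_Mapping.keys p \<subseteq> S"
    and "\<And>m. m \<in> S \<Longrightarrow> Poly_Mapping.keys m \<subseteq> V"
  shows "eval_mpoly p x =
    (\<Sum>m\<in>S. Poly_Mapping.lookup p m * (\<Prod>v\<in>V. x v ^ Poly_Mapping.lookup m v))"
proof -
  have "(\<Prod>v\<in>Poly_Mapping.keys m. x v ^ Poly_Mapping.lookup m v) =
      (\<Prod>v\<in>V. x v ^ Poly_Mapping.lookup m v)" if "m \<in> S" for m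
    using assms(1) assms(4)[OF that] by (intro prod.mono_neutral_left) (auto simp: in_keys_iff)
  then have "(\<Sum>m\<in>S. Poly_Mapping.lookup p m * (\<Prod>v\<in>V. x v ^ Poly_Mapping.lookup m v)) =
      (\<Sum>m\<in>S. Poly_Mapping.lookup p m *
        (\<Prod>v\<in>Poly_Mapping.keys m. x v ^ Poly_Mapping.lookup m v))"
    by (intro sum.cong) auto
  also have "\<dots> = eval_mpoly p x"
    unfolding eval_mpoly_def
    using assms(2,3) by (intro sum.mono_neutral_right) (auto simp: in_keys_iff)
  finally show ?thesis by simp
qed

text \<open>This gives the uniqueness of the blowup-polynomial.\<close>
lemma mpoly_eqI_positive:
  assumes V: "finite V"
    and p: "\<forall>m\<in>Poly_Mapping.keys p. Poly_Mapping.keys m \<subseteq> V"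
    and q: "\<forall>m\<in>Poly_Mapping.keys q. Poly_Mapping.keys m \<subseteq> V"
    and eq: "\<And>n :: 'v \<Rightarrow> nat. (\<And>v. v \<in> V \<Longrightarrow> 0 < n v) \<Longrightarrow>
      eval_mpoly p (\<lambda>v. int (n v)) = eval_mpoly q (\<lambda>v. int (n v))"
  shows "p = q"
proof (rule poly_mapping_eqI)
  fix m
  let ?S = "Poly_Mapping.keys p \<union> Poly_Mapping.keys q"
  have keys: "Poly_Mapping.keys m \<subseteq> V" if "m \<in> ?S" for m using that p q by blast
  show "Poly_Mapping.lookup p m = Poly_Mapping.lookup q m"
  proof (cases "m \<in> ?S")
    case True
    have "Poly_Mapping.lookup p m - Poly_Mapping.lookup q m = 0"
    proof (rule vanishing_on_positive_imp_coeffs_0[where e = Poly_Mapping.lookup and V = V and S = ?S])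
      fix m m' assume m: "m \<in> ?S" "m' \<in> ?S"
        "\<And>v. v \<in> V \<Longrightarrow> Poly_Mapping.lookup m v = Poly_Mapping.lookup m' v"
      show "m = m'"
      proof (rule poly_mapping_eqI)
        fix v
        have "v \<notin> Poly_Mapping.keys m" "v \<notin> Poly_Mapping.keys m'" if "v \<notin> V"
          using that keys[OF m(1)] keys[OF m(2)] by auto
        then show "Poly_Mapping.lookup m v = Poly_Mapping.lookup m' v"
          using m(3) by (cases "v \<in> V") (simp_all add: in_keys_iff)
      qed
    next
      fix n :: "'v \<Rightarrow> nat" assume "\<And>v. v \<in> V \<Longrightarrow> 0 < n v"
      from eq[OF this] show "(\<Sum>m\<in>?S. (Poly_Mapping.lookup p m - Poly_Mapping.lookup q m) *
          (\<Prod>v\<in>V. int (n v) ^ Poly_Mapping.lookup m v)) = 0"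
        using eval_mpoly_eq_sum[OF V, of ?S p "\<lambda>v. int (n v)"]
          eval_mpoly_eq_sum[OF V, of ?S q "\<lambda>v. int (n v)"] keys
        by (simp add: left_diff_distrib sum_subtractf)
    qed (use V True in auto)
    then show ?thesis by simp
  qed (auto simp: in_keys_iff)
qed

lemma lookup_sqfree_monomial:
  "finite I \<Longrightarrow> Poly_Mapping.lookup (sqfree_monomial I) v = (if v \<in> I then 1 else 0)"
  by (simp add: sqfree_monomial_def lookup_sum lookup_single when_def sum.delta)

lemma keys_sqfree_monomial: "finite I \<Longrightarrow> Poly_Mapping.keys (sqfree_monomial I) = I"
  by (auto simp: in_keys_iff lookup_sqfree_monomial split: if_splits)

definition multiaffine_mpoly :: "'v set \<Rightarrow> ('v set \<Rightarrow> int) \<Rightarrow> 'v int_mpoly" where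
  "multiaffine_mpoly V c = (\<Sum>I\<in>Pow V. Poly_Mapping.single (sqfree_monomial I) (c I))"

lemma lookup_multiaffine_mpoly:
  assumes "finite V" "I \<subseteq> V"
  shows "Poly_Mapping.lookup (multiaffine_mpoly V c) (sqfree_monomial I) = c I"
proof -
  have "sqfree_monomial J = sqfree_monomial I \<longleftrightarrow> J = I" if "J \<in> Pow V" for J
    using keys_sqfree_monomial[of I] keys_sqfree_monomial[of J] that assms
    by (metis PowD finite_subset)
  then have "Poly_Mapping.lookup (multiaffine_mpoly V c) (sqfree_monomial I) =
      (\<Sum>J\<in>Pow V. if J = I then c J else 0)"
    unfolding multiaffine_mpoly_def lookup_sum by (intro sum.cong) (auto simp: lookup_single when_def)
  then show ?thesis using assms by (simp add: sum.delta)
qed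

lemma keys_multiaffine_mpoly:
  "Poly_Mapping.keys (multiaffine_mpoly V c) \<subseteq> sqfree_monomial ` Pow V"
  unfolding multiaffine_mpoly_def
  by (rule order.trans[OF keys_sum]) (auto split: if_splits)

lemma eval_multiaffine_mpoly:
  assumes "finite V"
  shows "eval_mpoly (multiaffine_mpoly V c) x = (\<Sum>I\<in>Pow V. c I * (\<Prod>v\<in>I. x v))"
proof -
  have fin: "finite I" if "I \<in> Pow V" for I using that assms finite_subset by auto
  have inj: "inj_on sqfree_monomial (Pow V)"
    by (rule inj_on_inverseI[of _ Poly_Mapping.keys]) (simp add: fin keys_sqfree_monomial)
  have "eval_mpoly (multiaffine_mpoly V c) x =
      (\<Sum>m\<in>sqfree_monomial ` Pow V. Poly_Mapping.lookup (multiaffine_mpoly V c) m *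
        (\<Prod>v\<in>V. x v ^ Poly_Mapping.lookup m v))"
    using assms fin by (intro eval_mpoly_eq_sum keys_multiaffine_mpoly) (auto simp: keys_sqfree_monomial)
  also have "\<dots> = (\<Sum>I\<in>Pow V. Poly_Mapping.lookup (multiaffine_mpoly V c) (sqfree_monomial I) *
        (\<Prod>v\<in>V. x v ^ Poly_Mapping.lookup (sqfree_monomial I) v))"
    by (simp add: sum.reindex[OF inj])
  also have "\<dots> = (\<Sum>I\<in>Pow V. c I * (\<Prod>v\<in>I. x v))"
  proof (rule sum.cong[OF refl])
    fix I assume I: "I \<in> Pow V"
    have "(\<Prod>v\<in>V. x v ^ Poly_Mapping.lookup (sqfree_monomial I) v) =
        (\<Prod>v\<in>V. if v \<in> I then x v else 1)"
      by (intro prod.cong) (auto simp: lookup_sqfree_monomial fin[OF I])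
    also have "\<dots> = (\<Prod>v\<in>I. x v)"
      using I assms by (simp add: prod.If_cases Int_absorb1)
    finally show "Poly_Mapping.lookup (multiaffine_mpoly V c) (sqfree_monomial I) *
        (\<Prod>v\<in>V. x v ^ Poly_Mapping.lookup (sqfree_monomial I) v) = c I * (\<Prod>v\<in>I. x v)"
      using I assms by (simp add: lookup_multiaffine_mpoly)
  qed
  finally show ?thesis .
qed

section \<open>Distances in blowups\<close>

lemma (in pair_wf_digraph) awalk_length_iff_relpow:
  assumes "u \<in> pverts G"
  shows "(\<exists>p. awalk u p v \<and> length p = k) \<longleftrightarrow> (u, v) \<in> parcs G ^^ k"
  using assms
proof (induction k arbitrary: u)
  case 0
  then show ?case by (auto simp: awalk_Nil_iff)
next
  case (Suc k)
  have "(\<exists>p. awalk u p v \<and> length p = Suc k) \<longleftrightarrow>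
      (\<exists>w. (u, w) \<in> parcs G \<and> (\<exists>p. awalk w p v \<and> length p = k))"
  proof
    assume "\<exists>p. awalk u p v \<and> length p = Suc k"
    then obtain e q where "awalk u (e # q) v" "length q = k" by (auto simp: length_Suc_conv)
    then show "\<exists>w. (u, w) \<in> parcs G \<and> (\<exists>p. awalk w p v \<and> length p = k)"
      by (cases e) (auto simp: awalk_Cons_iff)
  next
    assume "\<exists>w. (u, w) \<in> parcs G \<and> (\<exists>p. awalk w p v \<and> length p = k)"
    then obtain w p where "(u, w) \<in> parcs G" "awalk w p v" "length p = k" by blast
    then show "\<exists>p. awalk u p v \<and> length p = Suc k"
      by (intro exI[of _ "(u, w) # p"]) (simp add: awalk_Cons_iff)
  qed
  also have "\<dots> \<longleftrightarrow> (\<exists>w. (u, w) \<in> parcs G \<and> (w, v) \<in> parcs G ^^ k)"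
    using Suc.IH[OF in_arcsD2] by blast
  also have "\<dots> \<longleftrightarrow> (u, v) \<in> parcs G ^^ Suc k"
    by (blast intro: relpow_Suc_I2 dest: relpow_Suc_D2)
  finally show ?case .
qed

lemma (in pair_wf_digraph) apath_if_awalk:
  assumes "awalk u p v"
  shows "\<exists>q. apath u q v \<and> length q \<le> length p"
  using assms
proof (induction rule: awalk_to_apath_induct)
  case (path p)
  then show ?case by (auto simp: apath_def)
next
  case (decomp p q r s)
  then have "p = q @ r @ s" by (auto elim: awalk_cyc_decompE)
  with decomp show ?case by (auto intro: le_trans)
qed

text \<open>
  Powers of the arc relation replace paths, because they can be compared between a graph and its
  blowup by induction on the length. Shortest walks and shortest paths have the same length, as
  cutting out cycles does not lengthen a walk.
\<close>
lemma (in pair_wf_digraph) graph_dist_eq_relpow: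
  assumes "u \<in> pverts G"
  shows "graph_dist G u v = (LEAST k. (u, v) \<in> parcs G ^^ k)"
proof -
  let ?P = "\<lambda>k. \<exists>p. apath u p v \<and> length p = k"
  let ?Q = "\<lambda>k. \<exists>p. awalk u p v \<and> length p = k"
  have PQ: "?Q k" if "?P k" for k using that by (auto intro: awalkI_apath)
  have QP: "\<exists>l\<le>k. ?P l" if "?Q k" for k using that apath_if_awalk by blast
  have "Least ?P = Least ?Q"
  proof (cases "\<exists>k. ?Q k")
    case True
    then obtain k where "?P k" using QP by blast
    then have "?P (Least ?P)" by (rule LeastI)
    moreover have "Least ?P \<le> k" if "?Q k" for k
    proof -
      obtain l where l: "l \<le> k" "?P l" using QP[OF \<open>?Q k\<close>] by blast
      show ?thesis using Least_le[of ?P, OF l(2)] l(1) by (rule order.trans)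
    qed
    ultimately show ?thesis by (intro Least_equality[symmetric] PQ)
  next
    case False
    then have "?P = ?Q" using PQ by blast
    then show ?thesis by simp
  qed
  then show ?thesis
    by (simp add: graph_dist_def awalk_length_iff_relpow[OF assms])
qed

lemma sym_relpow: "sym R \<Longrightarrow> (u, v) \<in> R ^^ k \<Longrightarrow> (v, u) \<in> R ^^ k"
proof (induction k arbitrary: v)
  case (Suc k)
  then obtain w where "(u, w) \<in> R ^^ k" "(w, v) \<in> R" by auto
  with Suc show ?case by (meson relpow_Suc_I2 symD)
qed simp

lemma (in pair_graph) dist_matrix_symmetric:
  assumes "u \<in> pverts G" "v \<in> pverts G"
  shows "dist_matrix G u v = dist_matrix G v u"
proof -
  have "sym (parcs G)" using pair_sym_arcs by (simp add: symmetric_def)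
  then have "(u, v) \<in> parcs G ^^ k \<longleftrightarrow> (v, u) \<in> parcs G ^^ k" for k
    by (blast intro: sym_relpow)
  then show ?thesis
    using assms by (simp add: dist_matrix_def graph_dist_eq_relpow)
qed

lemma pair_wf_digraph_blowup:
  assumes "pair_wf_digraph G"
  shows "pair_wf_digraph (blowup G n)"
proof -
  interpret pair_wf_digraph G by fact
  show ?thesis
    by unfold_locales (auto simp: blowup_def dest: in_arcsD1 in_arcsD2)
qed

context pair_graph
begin

lemma relpow_blowupD:
  "((v, i), (w, j)) \<in> parcs (blowup G n) ^^ k \<Longrightarrow> (v, w) \<in> parcs G ^^ k"
proof (induction k arbitrary: w j)
  case (Suc k)
  then obtain u l where "((v, i), (u, l)) \<in> parcs (blowup G n) ^^ k"
    "((u, l), (w, j)) \<in> parcs (blowup G n)" by auto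
  with Suc.IH show ?case by (auto simp: blowup_def)
qed simp

text \<open>
  A walk lifts along copies number \<open>0\<close> of its inner vertices. Its length must be positive, since a
  walk of length \<open>0\<close> does not connect two distinct copies of one vertex.
\<close>
lemma relpow_blowupI:
  assumes n: "\<forall>v\<in>pverts G. 0 < n v"
  shows "(v, w) \<in> parcs G ^^ Suc k \<Longrightarrow> i < n v \<Longrightarrow> j < n w \<Longrightarrow>
    ((v, i), (w, j)) \<in> parcs (blowup G n) ^^ Suc k"
proof (induction k arbitrary: w j)
  case 0
  then show ?case using no_loops' by (auto simp: blowup_def)
next
  case (Suc k)
  then obtain u where u: "(v, u) \<in> parcs G ^^ Suc k" "(u, w) \<in> parcs G" by auto
  then have "0 < n u" using n in_arcsD1 by blast
  then have "((v, i), (u, 0)) \<in> parcs (blowup G n) ^^ Suc k" by (rule Suc.IH[OF u(1) Suc.prems(2)])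
  moreover have "((u, 0), (w, j)) \<in> parcs (blowup G n)"
    using u(2) \<open>0 < n u\<close> Suc.prems(3) no_loops' by (auto simp: blowup_def)
  ultimately show ?case by (rule relpow_Suc_I)
qed

lemma ex_neighbour:
  assumes "Digraph_Component.connected (with_proj G)" "card (pverts G) \<ge> 2" "v \<in> pverts G"
  shows "\<exists>w. (v, w) \<in> parcs G"
proof -
  have "\<not> pverts G \<subseteq> {v}" using assms(2) card_mono[of "{v}" "pverts G"] by auto
  then obtain w where w: "w \<in> pverts G" "w \<noteq> v" by blast
  have "reachable (with_proj (mk_symmetric (with_proj G))) v w"
    using assms(1,3) w(1) by (auto simp: Digraph_Component.connected_def strongly_connected_def)
  then have "(v, w) \<in> (parcs (mk_symmetric (with_proj G)))\<^sup>*"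
    using reachable_rtranclI[of "with_proj (mk_symmetric (with_proj G))" v w] by simp
  then obtain u where "(v, u) \<in> parcs (mk_symmetric (with_proj G))"
    using w(2) by (auto elim: converse_rtranclE)
  then have "(v, u) \<in> parcs G \<or> (u, v) \<in> parcs G"
    by (auto simp: parcs_mk_symmetric)
  moreover have "sym (parcs G)" using pair_sym_arcs by (simp add: symmetric_def)
  ultimately show ?thesis by (meson symD)
qed

text \<open>
  On the diagonal \<open>M\<close> has the entry \<open>2\<close>, which is the distance of two distinct copies of a vertex:
  go to a neighbour and back.
\<close>
lemma dist_matrix_blowup:
  assumes "Digraph_Component.connected (with_proj G)" "card (pverts G) \<ge> 2"
    and n: "\<forall>v\<in>pverts G. 0 < n v"
    and x: "x \<in> pverts (blowup G n)" and y: "y \<in> pverts (blowup G n)"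
  shows "dist_matrix (blowup G n) x y = M_matrix G (fst x) (fst y) + (if x = y then - 2 else 0)"
proof -
  obtain v i w j where xy: "x = (v, i)" "y = (w, j)" by fastforce
  have v: "v \<in> pverts G" "i < n v" and w: "w \<in> pverts G" "j < n w"
    using x y by (auto simp: xy blowup_def)
  interpret B: pair_wf_digraph "blowup G n"
    by (rule pair_wf_digraph_blowup) (rule pair_wf_digraph)
  have dist: "graph_dist (blowup G n) x y = (LEAST k. (x, y) \<in> parcs (blowup G n) ^^ k)"
    using x by (rule B.graph_dist_eq_relpow)
  show ?thesis
  proof (cases "v = w")
    case False
    have "((v, i), (w, j)) \<in> parcs (blowup G n) ^^ k \<longleftrightarrow> (v, w) \<in> parcs G ^^ k" for k
    proof (cases k)
      case 0
      then show ?thesis using False by simp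
    next
      case (Suc l)
      show ?thesis
        unfolding Suc by (rule iffI[OF relpow_blowupD relpow_blowupI[OF n _ v(2) w(2)]])
    qed
    then have "graph_dist (blowup G n) x y = graph_dist G v w"
      by (simp add: dist graph_dist_eq_relpow[OF v(1)]) (simp add: xy)
    then show ?thesis
      using False by (simp add: M_matrix_def dist_matrix_def) (simp add: xy)
  next
    case True
    show ?thesis
    proof (cases "i = j")
      case True
      then show ?thesis using \<open>v = w\<close> by (simp add: xy M_matrix_def dist_matrix_def)
    next
      case False
      obtain u where u: "(v, u) \<in> parcs G" using ex_neighbour[OF assms(1,2) v(1)] by blast
      moreover have "(u, v) \<in> parcs G" using u pair_sym_arcs by (simp add: symmetric_def sym_def)
      ultimately have "(v, w) \<in> parcs G ^^ Suc (Suc 0)" using True by auto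
      then have "(x, y) \<in> parcs (blowup G n) ^^ 2"
        using relpow_blowupI[OF n _ v(2) w(2)] by (simp add: xy numeral_2_eq_2 del: relpow.simps)
      moreover have "2 \<le> k" if "(x, y) \<in> parcs (blowup G n) ^^ k" for k
      proof (rule ccontr)
        assume "\<not> 2 \<le> k"
        then have "k = 0 \<or> k = 1" by auto
        with that False True show False by (auto simp: xy blowup_def)
      qed
      ultimately have "graph_dist (blowup G n) x y = 2"
        unfolding dist by (intro Least_equality)
      then show ?thesis using False True by (simp add: xy M_matrix_def dist_matrix_def)
    qed
  qed
qed

end

section \<open>The blowup-polynomial as a sum over principal minors\<close>

text \<open>Such a \<open>J\<close> is the graph of a function choosing one copy of each \<open>v \<in> I\<close>.\<close>
lemma card_transversals:
  assumes "finite V" "I \<subseteq> V"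
  shows "card {J. J \<subseteq> (SIGMA v:V. {..<n v}) \<and> inj_on fst J \<and> fst ` J = I} = (\<Prod>v\<in>I. n v)"
proof -
  let ?G = "\<lambda>f. (\<lambda>v. (v, f v)) ` I"
  have fin: "finite I" using assms finite_subset by blast
  have "bij_betw ?G (PiE I (\<lambda>v. {..<n v}))
      {J. J \<subseteq> (SIGMA v:V. {..<n v}) \<and> inj_on fst J \<and> fst ` J = I}"
  proof (rule bij_betwI')
    fix f g assume fg: "f \<in> (\<Pi>\<^sub>E v\<in>I. {..<n v})" "g \<in> (\<Pi>\<^sub>E v\<in>I. {..<n v})"
    show "?G f = ?G g \<longleftrightarrow> f = g"
    proof
      assume eq: "?G f = ?G g"
      show "f = g"
      proof (rule PiE_ext[OF fg])
        fix v assume "v \<in> I"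
        then have "(v, f v) \<in> ?G g" using eq by blast
        then show "f v = g v" by auto
      qed
    qed simp
  next
    fix f assume "f \<in> (\<Pi>\<^sub>E v\<in>I. {..<n v})"
    then show "?G f \<in> {J. J \<subseteq> (SIGMA v:V. {..<n v}) \<and> inj_on fst J \<and> fst ` J = I}"
      using assms(2) by (force simp: inj_on_def image_image PiE_iff)
  next
    fix J assume "J \<in> {J. J \<subseteq> (SIGMA v:V. {..<n v}) \<and> inj_on fst J \<and> fst ` J = I}"
    then have J: "J \<subseteq> (SIGMA v:V. {..<n v})" "inj_on fst J" "fst ` J = I" by auto
    let ?s = "inv_into J fst"
    let ?f = "restrict (\<lambda>v. snd (?s v)) I"
    have s: "(v, snd (?s v)) \<in> J" if "v \<in> I" for v
      using that J(3) inv_into_into[of v fst J] f_inv_into_f[of v fst J]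
      by (metis prod.collapse)
    have "?G ?f = J"
    proof
      show "?G ?f \<subseteq> J" using s by auto
      show "J \<subseteq> ?G ?f"
      proof
        fix x assume x: "x \<in> J"
        then have "?s (fst x) = x" using J(2) by (rule inv_into_f_f[rotated])
        then show "x \<in> ?G ?f" using x J(3) by (intro image_eqI[of _ _ "fst x"]) auto
      qed
    qed
    moreover have "?f \<in> (\<Pi>\<^sub>E v\<in>I. {..<n v})" using s J(1) by auto
    ultimately show "\<exists>f\<in>\<Pi>\<^sub>E v\<in>I. {..<n v}. J = ?G f" by blast
  qed
  then have "card {J. J \<subseteq> (SIGMA v:V. {..<n v}) \<and> inj_on fst J \<and> fst ` J = I} =
      card (PiE I (\<lambda>v. {..<n v}))"
    by (simp add: bij_betw_same_card)
  then show ?thesis by (simp add: card_PiE[OF fin])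
qed

lemma sum_Pow_Sigma_transversals:
  fixes F :: "('v \<times> nat) set \<Rightarrow> 'r::comm_ring_1"
  assumes V: "finite V"
    and F0: "\<And>J. J \<subseteq> (SIGMA v:V. {..<n v}) \<Longrightarrow> \<not> inj_on fst J \<Longrightarrow> F J = 0"
    and Fg: "\<And>J. J \<subseteq> (SIGMA v:V. {..<n v}) \<Longrightarrow> inj_on fst J \<Longrightarrow> F J = g (fst ` J)"
  shows "(\<Sum>J\<in>Pow (SIGMA v:V. {..<n v}). F J) = (\<Sum>I\<in>Pow V. (\<Prod>v\<in>I. of_nat (n v)) * g I)"
proof -
  let ?S = "SIGMA v:V. {..<n v}"
  let ?T = "{J. J \<subseteq> ?S \<and> inj_on fst J}"
  have fin: "finite (Pow ?S)" using V by simp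
  have T: "finite ?T" by (rule finite_subset[OF _ fin]) auto
  have "(\<Sum>J\<in>Pow ?S. F J) = (\<Sum>J\<in>?T. g (fst ` J))"
    using fin by (intro sum.mono_neutral_cong_right) (auto simp: F0 Fg)
  also have "\<dots> = (\<Sum>I\<in>Pow V. \<Sum>J\<in>{J\<in>?T. fst ` J = I}. g (fst ` J))"
    using T V by (intro sum.group[symmetric]) auto
  also have "\<dots> = (\<Sum>I\<in>Pow V. (\<Prod>v\<in>I. of_nat (n v)) * g I)"
  proof (rule sum.cong[OF refl])
    fix I assume I: "I \<in> Pow V"
    have "(\<Sum>J\<in>{J\<in>?T. fst ` J = I}. g (fst ` J)) = of_nat (card {J\<in>?T. fst ` J = I}) * g I"
      by simp
    also have "card {J\<in>?T. fst ` J = I} = (\<Prod>v\<in>I. n v)"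
      using card_transversals[OF V, of I n] I by (simp add: conj_assoc)
    finally show "(\<Sum>J\<in>{J\<in>?T. fst ` J = I}. g (fst ` J)) = (\<Prod>v\<in>I. of_nat (n v)) * g I"
      by (simp add: of_nat_prod)
  qed
  finally show ?thesis .
qed

text \<open>
  The minors of the blown-up matrix on index sets with two copies of one vertex have two equal
  columns; the remaining index sets are partial transversals.
\<close>
lemma det_on_blowup_matrix:
  fixes M :: "'v \<Rightarrow> 'v \<Rightarrow> 'r::idom"
  assumes V: "finite V" and n: "\<forall>v\<in>V. 0 < n v"
  shows "det_on (SIGMA v:V. {..<n v}) (\<lambda>x y. M (fst x) (fst y) + (if x = y then c else 0)) =
    c ^ (\<Sum>v\<in>V. n v - 1) *
      (\<Sum>I\<in>Pow V. c ^ (card V - card I) * det_on I M * (\<Prod>v\<in>I. of_nat (n v)))"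
proof -
  let ?S = "SIGMA v:V. {..<n v}"
  let ?N = "\<lambda>x y. M (fst x) (fst y)"
  let ?K = "\<Sum>v\<in>V. n v - 1"
  have fin: "finite ?S" using V by simp
  have "card ?S = (\<Sum>v\<in>V. n v)" using V by simp
  also have "\<dots> = (\<Sum>v\<in>V. (n v - 1) + 1)" using n by (intro sum.cong) auto
  also have "\<dots> = ?K + card V" by (subst sum.distrib) simp
  finally have card: "card ?S = ?K + card V" .
  have "det_on ?S (\<lambda>x y. ?N x y + (if x = y then c else 0)) =
      (\<Sum>J\<in>Pow ?S. c ^ card (?S - J) * det_on J ?N)"
    unfolding det_on_add_diag[OF fin] by simp
  also have "\<dots> = (\<Sum>I\<in>Pow V. (\<Prod>v\<in>I. of_nat (n v)) * (c ^ (?K + (card V - card I)) * det_on I M))"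
  proof (rule sum_Pow_Sigma_transversals[OF V])
    fix J assume J: "J \<subseteq> ?S" "\<not> inj_on fst J"
    then obtain a b where "a \<in> J" "b \<in> J" "a \<noteq> b" "fst a = fst b" by (auto simp: inj_on_def)
    then have "det_on J ?N = 0"
      using finite_subset[OF J(1) fin] by (intro det_on_eq_cols[of J a b]) auto
    then show "c ^ card (?S - J) * det_on J ?N = 0" by simp
  next
    fix J assume J: "J \<subseteq> ?S" "inj_on fst J"
    have finJ: "finite J" using finite_subset[OF J(1) fin] .
    have "fst ` J \<subseteq> V" using J(1) by auto
    then have "card (fst ` J) \<le> card V" using V by (rule card_mono[rotated])
    then have "card (?S - J) = ?K + (card V - card (fst ` J))"
      using card_Diff_subset[OF finJ J(1)] card card_image[OF J(2)] by simp
    moreover have "det_on J ?N = det_on (fst ` J) M"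
      using det_on_reindex[OF finJ J(2), of M] by simp
    ultimately show "c ^ card (?S - J) * det_on J ?N =
        c ^ (?K + (card V - card (fst ` J))) * det_on (fst ` J) M" by simp
  qed
  also have "\<dots> = c ^ ?K * (\<Sum>I\<in>Pow V. c ^ (card V - card I) * det_on I M * (\<Prod>v\<in>I. of_nat (n v)))"
    by (simp add: sum_distrib_left power_add mult_ac)
  finally show ?thesis .
qed

lemma (in pair_graph) blowup_poly_eq_multiaffine_mpoly:
  assumes "Digraph_Component.connected (with_proj G)" "card (pverts G) \<ge> 2"
  shows "blowup_poly G =
    multiaffine_mpoly (pverts G) (\<lambda>I. (- 2) ^ (card (pverts G) - card I) * det_on I (M_matrix G))"
    (is "_ = ?p")
  unfolding blowup_poly_def
proof (rule the_equality)
  let ?V = "pverts G"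
  have keys: "\<forall>m\<in>Poly_Mapping.keys ?p. Poly_Mapping.keys m \<subseteq> ?V"
  proof
    fix m assume "m \<in> Poly_Mapping.keys ?p"
    then obtain I where "m = sqfree_monomial I" "I \<subseteq> ?V" using keys_multiaffine_mpoly by blast
    then show "Poly_Mapping.keys m \<subseteq> ?V"
      using finite_subset[OF _ pair_finite_verts] by (simp add: keys_sqfree_monomial)
  qed
  have det: "det_on (pverts (blowup G n)) (dist_matrix (blowup G n)) =
      (- 2) ^ (\<Sum>v\<in>?V. n v - 1) * eval_mpoly ?p (\<lambda>v. int (n v))"
    if n: "\<forall>v\<in>?V. 0 < n v" for n
  proof -
    have "det_on (pverts (blowup G n)) (dist_matrix (blowup G n)) =
        det_on (pverts (blowup G n))
          (\<lambda>x y. M_matrix G (fst x) (fst y) + (if x = y then - 2 else 0))"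
      by (intro det_on_cong dist_matrix_blowup[OF assms n])
    also have "\<dots> = (- 2) ^ (\<Sum>v\<in>?V. n v - 1) * eval_mpoly ?p (\<lambda>v. int (n v))"
      by (simp add: blowup_def det_on_blowup_matrix[OF pair_finite_verts n]
          eval_multiaffine_mpoly[OF pair_finite_verts])
    finally show ?thesis .
  qed
  show "is_blowup_poly G ?p" using keys det by (simp add: is_blowup_poly_def)
  fix q assume q: "is_blowup_poly G q"
  show "q = ?p"
  proof (rule mpoly_eqI_positive[OF pair_finite_verts _ keys])
    show "\<forall>m\<in>Poly_Mapping.keys q. Poly_Mapping.keys m \<subseteq> ?V"
      using q by (simp add: is_blowup_poly_def)
    fix n :: "'a \<Rightarrow> nat" assume "\<And>v. v \<in> ?V \<Longrightarrow> 0 < n v"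
    then have n: "\<forall>v\<in>?V. 0 < n v" by blast
    then have "(- 2) ^ (\<Sum>v\<in>?V. n v - 1) * eval_mpoly q (\<lambda>v. int (n v)) =
        (- 2) ^ (\<Sum>v\<in>?V. n v - 1) * eval_mpoly ?p (\<lambda>v. int (n v))"
      using q det[OF n] by (simp add: is_blowup_poly_def)
    then show "eval_mpoly q (\<lambda>v. int (n v)) = eval_mpoly ?p (\<lambda>v. int (n v))" by simp
  qed
qed

section \<open>The delta-matroid of the blowup-polynomial\<close>

theorem mainTheorem6:
  fixes G :: "'v pair_pre_digraph"
  assumes "pair_graph G"
    and "Digraph_Component.connected (with_proj G)"
    and "card (pverts G) \<ge> 2"
  shows "delta_matroid (pverts G) (blowup_feasible G) \<and>
    blowup_feasible G = {I. I \<subseteq> pverts G \<and> det_on I (M_matrix G) \<noteq> 0}"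
proof -
  interpret pair_graph G by fact
  have F: "blowup_feasible G = {I. I \<subseteq> pverts G \<and> det_on I (M_matrix G) \<noteq> 0}"
    unfolding blowup_feasible_def blowup_poly_eq_multiaffine_mpoly[OF assms(2,3)]
    using lookup_multiaffine_mpoly[OF pair_finite_verts] by auto
  have "delta_matroid (pverts G) {I. I \<subseteq> pverts G \<and> det_on I (M_matrix G) \<noteq> 0}"
    using pair_finite_verts
  proof (rule delta_matroid_nonsingular_principal)
    show "M_matrix G i j = M_matrix G j i" if "i \<in> pverts G" "j \<in> pverts G" for i j
      using dist_matrix_symmetric[OF that] by (simp add: M_matrix_def)
  qed (simp add: M_matrix_def dist_matrix_def)
  then show ?thesis by (simp add: F)
qed

end
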